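(* Let $m,l$ be positive integers with $l>m$. Then the AWG $\mathcal{A}(m,l)$ is equivalent to the generalized shuffle network $\mathcal{N}(m,l)$ in terms of the connectivity between input channels and output channels. That is, regard the $l$ wavelength channels at each input of $\mathcal{A}(m,l)$ as an input group and the $m$ wavelength channels at each output as an output group. Label the input channel $(p,\lambda_{[p+q]_l})$ by the field address $\underline{p}\,\underline{q}$ and the output channel $(q,\lambda_{[q+p]_l})$ by the field address $\underline{q}\,\underline{p}$, for $0\le p\le m-1$ and $0\le q\le l-1$. Then each input group $p$ is connected to each output group $q$ via exactly one connection, namely $\tilde C_A(p,q,\lambda_{[p+q]_l})$, which joins input channel $\underline{p}\,\underline{q}$ to output channel $\underline{q}\,\underline{p}$. Moreover, $\tilde C_A(p,q,\lambda_{[p+q]_l})\leftrightarrow C(\underline{p}\,\underline{q},\underline{q}\,\underline{p})$ is a one-to-one and onto correspondence between the connections of $\mathcal{A}(m,l)$ and the connections of $\mathcal{N}(m,l)$.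
   Context: Notation: $[X]_l$ denotes $X \bmod l$, taken in $\{0,\dots,l-1\}$. Generalized shuffle network $\mathcal{N}(m,l)$: it has $N=ml$ inputs divided into $m$ input groups of $l$ ports each, and $N$ outputs divided into $l$ output groups of $m$ ports each. For $p=0,\dots,m-1$ and $q=0,\dots,l-1$, the $q$th port of input group $p$ (address $\underline{p}\,\underline{q}$) is connected to the $p$th port of output group $q$ (address $\underline{q}\,\underline{p}$). This connection is denoted $C(\underline{p}\,\underline{q},\underline{q}\,\underline{p})$, and there are no other connections. A network is functionally equivalent to $\mathcal{N}(m,l)$ if (F1) each input group connects with each output group via exactly one connection, and (F2) each input connects to the output whose address is obtained by exchanging the two sub-addresses of the input address. AWG $\mathcal{A}(m,l)$ with $l>m$ (arrayed waveguide grating): a passive wavelength router with inputs $p=0,\dots,m-1$, outputs $q=0,\dots,l-1$ and wavelength set $\{\lambda_0,\dots,\lambda_{l-1}\}$. Input $p$ is connected to output $q$ via wavelength $\lambda_i$ if and only if $i=[p+q]_l$ (a signal keeps its wavelength). This connection is denoted $\tilde C_A(p,q,\lambda_{[p+q]_l})$. An input channel is a pair $(p,\lambda_i)$ (each input carries $l$ wavelength channels). An output channel is a pair $(q,\lambda_i)$ with $i=[p+q]_l$ for some input $p$ (each output carries $m$ wavelength channels). *)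

theory Defs
  imports Main
begin

text \<open>A network given by its set of connections, each running from an input to an output, where
  inputs and outputs are partitioned into numbered groups.\<close>

record ('i, 'o, 'c) network =
  inputs :: "'i set"
  outputs :: "'o set"
  conns :: "'c set"
  source :: "'c \<Rightarrow> 'i"
  target :: "'c \<Rightarrow> 'o"
  in_group :: "'i \<Rightarrow> nat"
  out_group :: "'o \<Rightarrow> nat"

definition wf_network :: "('i, 'o, 'c) network \<Rightarrow> bool" where
  "wf_network N \<longleftrightarrow>
     (\<forall>c \<in> conns N. source N c \<in> inputs N \<and> target N c \<in> outputs N)"

text \<open>A field address is a pair of sub-addresses, the first being the number of the group.\<close>

type_synonym address = "nat \<times> nat"

definition in_addresses :: "nat \<Rightarrow> nat \<Rightarrow> address set" where
  "in_addresses m l = {..<m} \<times> {..<l}"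

definition out_addresses :: "nat \<Rightarrow> nat \<Rightarrow> address set" where
  "out_addresses m l = {..<l} \<times> {..<m}"

text \<open>A labelling is given in the direction from addresses to inputs (\<open>a\<close>) and to outputs (\<open>b\<close>).
  It must give every input and every output exactly one address, in accordance with the groups, so
  that there are \<open>m\<close> input groups of \<open>l\<close> inputs and \<open>l\<close> output groups of \<open>m\<close> outputs.\<close>

definition valid_labelling ::
  "nat \<Rightarrow> nat \<Rightarrow> ('i, 'o, 'c) network \<Rightarrow> (address \<Rightarrow> 'i) \<Rightarrow> (address \<Rightarrow> 'o) \<Rightarrow> bool" where
  "valid_labelling m l N a b \<longleftrightarrow>
     bij_betw a (in_addresses m l) (inputs N) \<and>
     bij_betw b (out_addresses m l) (outputs N) \<and>
     (\<forall>x \<in> in_addresses m l. in_group N (a x) = fst x) \<and>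
     (\<forall>y \<in> out_addresses m l. out_group N (b y) = fst y)"

definition cond_F1 :: "nat \<Rightarrow> nat \<Rightarrow> ('i, 'o, 'c) network \<Rightarrow> bool" where
  "cond_F1 m l N \<longleftrightarrow>
     (\<forall>p<m. \<forall>q<l. \<exists>!c. c \<in> conns N \<and>
        in_group N (source N c) = p \<and> out_group N (target N c) = q)"

definition cond_F2 ::
  "nat \<Rightarrow> nat \<Rightarrow> ('i, 'o, 'c) network \<Rightarrow> (address \<Rightarrow> 'i) \<Rightarrow> (address \<Rightarrow> 'o) \<Rightarrow> bool" where
  "cond_F2 m l N a b \<longleftrightarrow>
     (\<forall>p<m. \<forall>q<l. \<forall>y \<in> outputs N.
        (\<exists>c \<in> conns N. source N c = a (p, q) \<and> target N c = y) \<longleftrightarrow> y = b (q, p))"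

definition functionally_equivalent ::
  "nat \<Rightarrow> nat \<Rightarrow> ('i, 'o, 'c) network \<Rightarrow> (address \<Rightarrow> 'i) \<Rightarrow> (address \<Rightarrow> 'o) \<Rightarrow> bool" where
  "functionally_equivalent m l N a b \<longleftrightarrow>
     wf_network N \<and> valid_labelling m l N a b \<and> cond_F1 m l N \<and> cond_F2 m l N a b"

definition shuffle_conn :: "nat \<Rightarrow> nat \<Rightarrow> address \<times> address" where
  "shuffle_conn p q = ((p, q), (q, p))"

definition shuffle_network :: "nat \<Rightarrow> nat \<Rightarrow> (address, address, address \<times> address) network" where
  "shuffle_network m l =
     \<lparr>inputs = in_addresses m l,
      outputs = out_addresses m l,
      conns = {shuffle_conn p q | p q. p < m \<and> q < l},
      source = fst,
      target = snd,
      in_group = fst,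
      out_group = fst\<rparr>"

lemma shuffle_network_functionally_equivalent:
  "functionally_equivalent m l (shuffle_network m l) id id"
  unfolding functionally_equivalent_def wf_network_def valid_labelling_def cond_F1_def cond_F2_def
    shuffle_network_def shuffle_conn_def in_addresses_def out_addresses_def
  by auto

text \<open>A channel is a pair of a port and the index of a wavelength; a connection \<open>(p, q, i)\<close> of the
  AWG goes from input \<open>p\<close> to output \<open>q\<close> via wavelength \<open>i\<close>.\<close>

type_synonym channel = "nat \<times> nat"
type_synonym awg_connection = "nat \<times> nat \<times> nat"

definition awg_connected :: "nat \<Rightarrow> nat \<Rightarrow> nat \<Rightarrow> nat \<Rightarrow> nat \<Rightarrow> bool" where
  "awg_connected m l p q i \<longleftrightarrow> p < m \<and> q < l \<and> i < l \<and> i = (p + q) mod l"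

definition awg_network :: "nat \<Rightarrow> nat \<Rightarrow> (channel, channel, awg_connection) network" where
  "awg_network m l =
     \<lparr>inputs = {(p, i). p < m \<and> i < l},
      outputs = {(q, i). q < l \<and> (\<exists>p<m. i = (p + q) mod l)},
      conns = {(p, q, i). awg_connected m l p q i},
      source = (\<lambda>(p, q, i). (p, i)),
      target = (\<lambda>(p, q, i). (q, i)),
      in_group = fst,
      out_group = fst\<rparr>"

definition awg_conn :: "nat \<Rightarrow> nat \<Rightarrow> nat \<Rightarrow> awg_connection" where
  "awg_conn l p q = (p, q, (p + q) mod l)"

definition awg_in_label :: "nat \<Rightarrow> address \<Rightarrow> channel" where
  "awg_in_label l = (\<lambda>(p, q). (p, (p + q) mod l))"

definition awg_out_label :: "nat \<Rightarrow> address \<Rightarrow> channel" where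
  "awg_out_label l = (\<lambda>(q, p). (q, (q + p) mod l))"

definition awg_to_shuffle :: "awg_connection \<Rightarrow> address \<times> address" where
  "awg_to_shuffle = (\<lambda>(p, q, i). shuffle_conn p q)"

end

theory Submission
  imports Defs "HOL-Number_Theory.Cong"
begin

text \<open>In the AWG the wavelength of a connection is forced by its two ports, so connections
  correspond to pairs \<open>(p, q)\<close>, exactly as in the shuffle network. The labels are
  legitimate because adding a constant modulo \<open>l\<close> permutes the residues: at input
  \<open>p\<close> each wavelength leads to exactly one output
  (\<open>bij_betw_awg_in_label\<close>), and at output \<open>q\<close> the \<open>m\<close> inputs
  use distinct wavelengths (\<open>bij_betw_awg_out_label\<close>). As a signal keeps its
  wavelength, a connection swaps the sub-addresses.\<close>

lemma mod_add_left_cancel_less: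
  fixes p q q' l :: nat
  assumes "(p + q) mod l = (p + q') mod l" "q < l" "q' < l"
  shows "q = q'"
  using assms by (metis cong_add_lcancel_nat cong_def mod_less)

text \<open>Cancellation gives injectivity, and an injective self-map of a finite set is
  onto.\<close>

lemma bij_betw_mod_add:
  fixes p l :: nat
  assumes "0 < l"
  shows "bij_betw (\<lambda>q. (p + q) mod l) {..<l} {..<l}"
proof -
  have "inj_on (\<lambda>q. (p + q) mod l) {..<l}"
    by (auto intro: inj_onI dest: mod_add_left_cancel_less)
  moreover from this have "(\<lambda>q. (p + q) mod l) ` {..<l} = {..<l}"
    using assms by (intro endo_inj_surj) auto
  ultimately show ?thesis
    by (simp add: bij_betw_def)
qed

lemma awg_conns_eq:
  assumes "0 < l"
  shows "conns (awg_network m l) = {awg_conn l p q | p q. p < m \<and> q < l}"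
  using assms by (auto simp: awg_network_def awg_connected_def awg_conn_def)

lemma bij_betw_awg_in_label:
  assumes "0 < l"
  shows "bij_betw (awg_in_label l) (in_addresses m l) (inputs (awg_network m l))"
  unfolding bij_betw_def
proof
  show "inj_on (awg_in_label l) (in_addresses m l)"
    by (auto simp: awg_in_label_def in_addresses_def intro!: inj_onI
        dest: mod_add_left_cancel_less)
  \<comment> \<open>Surjectivity is the real content: the second sub-address is the output that
    input \<open>p\<close> reaches via wavelength \<open>i\<close>.\<close>
  have "(p, i) \<in> awg_in_label l ` in_addresses m l" if "p < m" "i < l" for p i
  proof -
    obtain q where "q < l" "i = (p + q) mod l"
      using bij_betw_mod_add[OF assms, of p] \<open>i < l\<close> by (auto simp: bij_betw_def)
    then show ?thesis
      using \<open>p < m\<close> by (force simp: awg_in_label_def in_addresses_def)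
  qed
  then show "awg_in_label l ` in_addresses m l = inputs (awg_network m l)"
    using assms by (auto simp: awg_network_def awg_in_label_def in_addresses_def)
qed

text \<open>Output channels are by definition those reached from some input, so surjectivity is
  immediate; \<open>m \<le> l\<close> makes the inputs distinct residues modulo \<open>l\<close>,
  whence injectivity.\<close>

lemma bij_betw_awg_out_label:
  assumes "m \<le> l"
  shows "bij_betw (awg_out_label l) (out_addresses m l) (outputs (awg_network m l))"
  unfolding bij_betw_def
proof
  show "inj_on (awg_out_label l) (out_addresses m l)"
    using assms by (auto simp: awg_out_label_def out_addresses_def intro!: inj_onI
        dest: mod_add_left_cancel_less)
  show "awg_out_label l ` out_addresses m l = outputs (awg_network m l)"
    by (force simp: awg_network_def awg_out_label_def out_addresses_def add.commute)
qed

lemma awg_functionally_equivalent: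
  assumes "0 < l" "m \<le> l"
  shows "functionally_equivalent m l (awg_network m l) (awg_in_label l) (awg_out_label l)"
  unfolding functionally_equivalent_def
proof (intro conjI)
  show "wf_network (awg_network m l)"
    by (auto simp: wf_network_def awg_network_def awg_connected_def)
  show "valid_labelling m l (awg_network m l) (awg_in_label l) (awg_out_label l)"
    using bij_betw_awg_in_label[OF assms(1)] bij_betw_awg_out_label[OF assms(2)]
    by (auto simp: valid_labelling_def awg_network_def awg_in_label_def awg_out_label_def)
  show "cond_F1 m l (awg_network m l)"
    using assms(1) by (auto simp: cond_F1_def awg_network_def awg_connected_def)
  \<comment> \<open>A connection leaving \<open>(p, (p + q) mod l)\<close> for output
    \<open>q'\<close> satisfies \<open>(p + q') mod l = (p + q) mod l\<close>, so cancellation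
    yields \<open>q' = q\<close>.\<close>
  show "cond_F2 m l (awg_network m l) (awg_in_label l) (awg_out_label l)"
    using assms(1)
    by (auto simp: cond_F2_def awg_network_def awg_connected_def awg_in_label_def
        awg_out_label_def add.commute dest: mod_add_left_cancel_less)
qed

text \<open>Forgetting the wavelength loses nothing, since \<open>p\<close> and \<open>q\<close>
  determine it.\<close>

lemma bij_betw_awg_to_shuffle:
  assumes "0 < l"
  shows "bij_betw awg_to_shuffle (conns (awg_network m l)) (conns (shuffle_network m l))"
  unfolding bij_betw_def awg_conns_eq[OF assms]
  by (force simp: awg_conn_def awg_to_shuffle_def shuffle_conn_def shuffle_network_def
      intro!: inj_onI)

theorem mainTheorem1:
  fixes m l :: nat
  assumes "0 < m" and "0 < l" and "m < l"
  defines "A \<equiv> awg_network m l" and "S \<equiv> shuffle_network m l"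
  shows
    "functionally_equivalent m l A (awg_in_label l) (awg_out_label l) \<and>
     (\<forall>p<m. \<forall>q<l.
        awg_conn l p q \<in> conns A \<and>
        source A (awg_conn l p q) = awg_in_label l (p, q) \<and>
        target A (awg_conn l p q) = awg_out_label l (q, p) \<and>
        (\<forall>c \<in> conns A. in_group A (source A c) = p \<and> out_group A (target A c) = q
           \<longrightarrow> c = awg_conn l p q)) \<and>
     (\<forall>p<m. \<forall>q<l. awg_to_shuffle (awg_conn l p q) = shuffle_conn p q) \<and>
     bij_betw awg_to_shuffle (conns A) (conns S) \<and>
     (\<forall>c \<in> conns A.
        source A c = awg_in_label l (source S (awg_to_shuffle c)) \<and>
        target A c = awg_out_label l (target S (awg_to_shuffle c)))"
proof (intro conjI)
  show "functionally_equivalent m l A (awg_in_label l) (awg_out_label l)"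
    unfolding A_def using assms(2,3) by (simp add: awg_functionally_equivalent)
  show "bij_betw awg_to_shuffle (conns A) (conns S)"
    unfolding A_def S_def using assms(2) by (rule bij_betw_awg_to_shuffle)
\<comment> \<open>\<open>add.commute\<close> reconciles \<open>p + q\<close> in connections with
  \<open>q + p\<close> in output labels.\<close>
qed (use assms(2) in \<open>auto simp: A_def S_def awg_network_def shuffle_network_def awg_connected_def
    awg_conn_def awg_in_label_def awg_out_label_def awg_to_shuffle_def shuffle_conn_def
    add.commute\<close>)

end
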